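(* Let $(\Omega,\mathcal{B},\nu,f)$ be a dynamical system, where $\Omega$ is an invariant set in some manifold (usually $\mathbb{R}^d$) equipped with a distance $\mathrm{dist}$, $\mathcal{B}$ is the Borel $\sigma$-algebra, $f:\Omega\to\Omega$ is measurable and $\nu$ is an $f$-invariant Borel probability measure. For $\zeta\in\Omega$ and $m\ge 0$ let $X_m(x)=-\log\big(\mathrm{dist}(f^m(x),\zeta)\big)$ (with value $+\infty$ when $f^m(x)=\zeta$), and let $B_r(\zeta)=\{x\in\Omega:\mathrm{dist}(x,\zeta)<r\}$. Suppose that: 1. for $\nu$-almost every $\zeta$, the process $(X_m)_{m\ge 0}$ satisfies the conditions $D_2(u_m)$ and $D'(u_m)$ (defined in the context); 2. for $\nu$-almost every $\zeta$, the function $r\mapsto \nu(B_r(\zeta))$ is continuous; moreover $\nu$ has no atoms; 3. there is a number $\Delta$ such that for $\nu$-almost every $\zeta$ the limit $\lim_{r\to 0}\frac{\log \nu(B_r(\zeta))}{\log r}$ exists and equals $\Delta$. For $u\in\mathbb{R}$ let $F(u)=\nu(\{x\in\Omega: X_0(x)\le u\})$, and for $m\ge 2$ let $\gamma_m=F^{-1}(1-1/m)=\inf\{u\in\mathbb{R}: F(u)\ge 1-1/m\}$ (both depend on $\zeta$). Then, for $\nu$-almost every $\zeta\in\Omega$, $$\lim_{m\to\infty}\frac{\log m}{\gamma_m}=\Delta .$$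
   Context: Conditions $D_2$ and $D'$. Let $M_m=\max\{X_0,\dots,X_{m-1}\}$ denote the partial maximum of the stationary process $(X_m)_{m\ge0}$. The levels are $u_m=\frac{y}{a_m}+b_m$, $y\in\mathbb{R}$, where $(a_m),(b_m)$ are real normalising sequences for the maxima, such that $m\,\nu(X_0>u_m)\to\tau$ as $m\to\infty$ for some $\tau>0$ (possibly depending on $y$). Put $M_{j,l}=\max\{X_j,X_{j+1},\dots,X_{j+l}\}$. Condition $D_2(u_m)$ holds for the sequence $(X_m)$ if for all integers $l,t,m$ $$|\nu(X_0>u_m,\ M_{t,l}\le u_m)-\nu(X_0>u_m)\,\nu(M_{t,l}\le u_m)|\le \gamma(m,t),$$ where $\gamma(m,t)$ is non-increasing in $t$ for each $m$ and $m\,\gamma(m,t_m)\to0$ as $m\to\infty$ for some sequence $t_m=o(m)$ with $t_m\to\infty$. (This function $\gamma(m,t)$ is unrelated to the quantile $\gamma_m$.) Condition $D'(u_m)$ holds for the sequence $(X_m)$ if $$\lim_{l\to\infty}\limsup_{m\to\infty}\ m\sum_{j=1}^{\lfloor m/l\rfloor}\nu(X_0>u_m,\ X_j>u_m)=0 .$$ The number $\Delta$ is the Hausdorff dimension of the measure $\nu$ (information dimension). *)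

theory Defs
  imports "HOL-Probability.Probability" "HOL-Library.Landau_Symbols"
begin

text \<open>A metrised topological manifold: the topology is the one induced by the distance of the
  ambient metric type on the carrier \<open>M\<close> (so it is Hausdorff). No smooth structure and no
  connectedness is required.\<close>

definition topological_manifold :: "nat \<Rightarrow> 'a::metric_space set \<Rightarrow> bool" where
  "topological_manifold d M \<longleftrightarrow>
     second_countable (top_of_set M) \<and>
     (\<forall>x\<in>M. \<exists>U V. openin (top_of_set M) U \<and> x \<in> U \<and> openin (Euclidean_space d) V \<and>
        top_of_set U homeomorphic_space subtopology (Euclidean_space d) V)"

definition log_dist_process :: "('a::metric_space \<Rightarrow> 'a) \<Rightarrow> 'a \<Rightarrow> nat \<Rightarrow> 'a \<Rightarrow> ereal" where
  "log_dist_process f \<zeta> m x =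
     (if (f ^^ m) x = \<zeta> then \<infinity> else ereal (- ln (dist ((f ^^ m) x) \<zeta>)))"

definition block_max :: "(nat \<Rightarrow> 'a \<Rightarrow> ereal) \<Rightarrow> nat \<Rightarrow> nat \<Rightarrow> 'a \<Rightarrow> ereal" where
  "block_max X j l x = Max ((\<lambda>i. X i x) ` {j..j + l})"

definition condition_D2 :: "'a measure \<Rightarrow> (nat \<Rightarrow> 'a \<Rightarrow> ereal) \<Rightarrow> (nat \<Rightarrow> real) \<Rightarrow> bool" where
  "condition_D2 \<nu> X u \<longleftrightarrow>
     (\<exists>\<gamma> :: nat \<Rightarrow> nat \<Rightarrow> real.
        (\<forall>l t m.
           \<bar>measure \<nu> {x \<in> space \<nu>. X 0 x > ereal (u m) \<and> block_max X t l x \<le> ereal (u m)}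
             - measure \<nu> {x \<in> space \<nu>. X 0 x > ereal (u m)}
               * measure \<nu> {x \<in> space \<nu>. block_max X t l x \<le> ereal (u m)}\<bar> \<le> \<gamma> m t) \<and>
        (\<forall>m. antimono (\<gamma> m)) \<and>
        (\<exists>t :: nat \<Rightarrow> nat. filterlim t at_top sequentially \<and>
           (\<lambda>m. real (t m)) \<in> o(\<lambda>m. real m) \<and>
           (\<lambda>m. real m * \<gamma> m (t m)) \<longlonglongrightarrow> 0))"

definition condition_D' :: "'a measure \<Rightarrow> (nat \<Rightarrow> 'a \<Rightarrow> ereal) \<Rightarrow> (nat \<Rightarrow> real) \<Rightarrow> bool" where
  "condition_D' \<nu> X u \<longleftrightarrow>
     (\<lambda>l. limsup (\<lambda>m. ereal (real m *
        (\<Sum>j = 1..m div l. measure \<nu> {x \<in> space \<nu>. X 0 x > ereal (u m) \<and> X j x > ereal (u m)}))))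
     \<longlonglongrightarrow> 0"

text \<open>The normalising sequences are allowed to be negative; \<open>a m \<noteq> 0\<close> only makes \<open>y / a m\<close>
  meaningful. The index 0 is irrelevant and therefore unconstrained.\<close>

definition normalising_seqs ::
  "'a measure \<Rightarrow> (nat \<Rightarrow> 'a \<Rightarrow> ereal) \<Rightarrow> (nat \<Rightarrow> real) \<Rightarrow> (nat \<Rightarrow> real) \<Rightarrow> bool" where
  "normalising_seqs \<nu> X a b \<longleftrightarrow>
     (\<forall>m\<ge>1. a m \<noteq> 0) \<and>
     (\<forall>y. \<exists>\<tau>>0. (\<lambda>m. real m * measure \<nu> {x \<in> space \<nu>. X 0 x > ereal (y / a m + b m)}) \<longlonglongrightarrow> \<tau>)"

definition distr_fun :: "'a measure \<Rightarrow> ('a \<Rightarrow> ereal) \<Rightarrow> real \<Rightarrow> real" where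
  "distr_fun \<nu> Y u = measure \<nu> {x \<in> space \<nu>. Y x \<le> ereal u}"

text \<open>Only meaningful for \<open>m \<ge> 2\<close>; for smaller \<open>m\<close> the real infimum below may be a junk value.\<close>

definition quantile_seq :: "'a measure \<Rightarrow> ('a \<Rightarrow> ereal) \<Rightarrow> nat \<Rightarrow> real" where
  "quantile_seq \<nu> Y m = Inf {u :: real. distr_fun \<nu> Y u \<ge> 1 - 1 / real m}"

end

theory Submission
  imports Defs
begin

text \<open>Write \<open>g r\<close> for the measure of the ball of radius \<open>r\<close> around \<open>\<zeta>\<close>. Since \<open>- ln (dist x \<zeta>) \<le> u\<close> says
  exactly that \<open>x\<close> lies outside the ball of radius \<open>exp (- u)\<close>, the distribution function of the
  observable is \<open>1 - g (exp (- u))\<close>, so the quantile \<open>\<gamma>\<^sub>m\<close> is the least \<open>u\<close> with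
  \<open>g (exp (- u)) \<le> 1 / m\<close>. Continuity of \<open>g\<close> turns this inequality into the equation
  \<open>g (exp (- \<gamma>\<^sub>m)) = 1 / m\<close> (\<open>Inf_sublevel_attained\<close>). Setting \<open>r\<^sub>m = exp (- \<gamma>\<^sub>m)\<close>, the quotient
  \<open>ln m / \<gamma>\<^sub>m\<close> is nothing but \<open>ln (g r\<^sub>m) / ln r\<^sub>m\<close>, and the local dimension formula gives the claim as
  soon as \<open>r\<^sub>m\<close> tends to \<open>0\<close>.

  As \<open>g r\<^sub>m = 1 / m\<close> tends to \<open>0\<close>, this last point holds precisely if \<open>g\<close> has no zero at a positive
  radius, that is, if \<open>\<zeta>\<close> belongs to the support of \<open>\<nu>\<close>. By second countability of the
  manifold the complement of the support is a countable union of null sets, hence null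
  (\<open>AE_measure_ball_pos\<close>).\<close>

text \<open>A monotone function may jump across the level \<open>c\<close> at the infimum, from above \<open>c\<close> to below it;
  continuity excludes the jump.\<close>

lemma Inf_sublevel_attained:
  fixes h :: "real \<Rightarrow> real"
  assumes cont: "continuous_on UNIV h" and anti: "antimono h"
    and low: "\<exists>u. h u \<le> c" and high: "\<exists>u. c < h u"
  shows "h (Inf {u. h u \<le> c}) = c"
proof -
  let ?S = "{u. h u \<le> c}"
  have closed: "closed ?S"
    using cont by (intro closed_Collect_le) auto
  obtain v where v: "c < h v" using high by blast
  have "v \<le> u" if "u \<in> ?S" for u
    using that v antimonoD[OF anti, of u v] by (cases "v \<le> u") auto
  hence bdd: "bdd_below ?S" by (intro bdd_belowI)
  have in_S: "Inf ?S \<in> ?S"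
    using closed_contains_Inf[OF _ bdd closed] low by blast
  moreover have "\<not> h (Inf ?S) < c"
  proof
    assume less: "h (Inf ?S) < c"
    \<comment> \<open>By continuity the strict inequality persists slightly to the left of the infimum.\<close>
    have "open {u. h u < c}"
      using cont by (intro open_Collect_less) auto
    then obtain e where "e > 0" and e: "ball (Inf ?S) e \<subseteq> {u. h u < c}"
      using less unfolding open_contains_ball by blast
    have "Inf ?S - e / 2 \<in> ball (Inf ?S) e"
      using \<open>e > 0\<close> by (simp add: dist_real_def)
    with e have "h (Inf ?S - e / 2) < c" by blast
    hence "Inf ?S - e / 2 \<in> ?S" by simp
    from cInf_lower[OF this bdd] \<open>e > 0\<close> show False by simp
  qed
  ultimately show ?thesis by simp
qed

text \<open>The purely analytic core: \<open>g\<close> plays the role of the measure of balls around a fixed point of the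
  support.\<close>

lemma ln_over_quantile_tendsto:
  fixes g :: "real \<Rightarrow> real"
  assumes cont: "continuous_on {0<..} g" and mono: "mono_on {0<..} g"
    and pos: "\<And>r. r > 0 \<Longrightarrow> g r > 0"
    and small: "\<And>e. e > 0 \<Longrightarrow> \<exists>r>0. g r < e"
    and large: "\<And>e. e < 1 \<Longrightarrow> \<exists>r>0. e < g r"
    and lim: "((\<lambda>r. ln (g r) / ln r) \<longlongrightarrow> \<Delta>) (at_right 0)"
  shows "(\<lambda>m. ln (real m) / Inf {u. g (exp (- u)) \<le> 1 / real m}) \<longlonglongrightarrow> \<Delta>"
proof -
  let ?h = "\<lambda>u. g (exp (- u))"
  define q where "q m = Inf {u. ?h u \<le> 1 / real m}" for m :: nat
  have conth: "continuous_on UNIV ?h"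
    by (rule continuous_on_compose2[OF cont]) (auto intro!: continuous_intros)
  have anti: "antimono ?h"
    by (intro antimonoI mono_onD[OF mono]) auto
  have q: "g (exp (- q m)) = 1 / real m" if m: "m \<ge> 2" for m
    unfolding q_def
  proof (rule Inf_sublevel_attained[OF conth anti])
    obtain r where "r > 0" "g r < 1 / real m" using small[of "1 / real m"] m by auto
    thus "\<exists>u. ?h u \<le> 1 / real m" by (intro exI[of _ "- ln r"]) simp
    obtain s where "s > 0" "1 / real m < g s" using large[of "1 / real m"] m by auto
    thus "\<exists>u. 1 / real m < ?h u" by (intro exI[of _ "- ln s"]) simp
  qed
  have "(\<lambda>m. exp (- q m)) \<longlonglongrightarrow> 0"
  proof (rule tendstoI)
    fix e :: real assume "e > 0"
    have "(\<lambda>m. 1 / real m) \<longlonglongrightarrow> 0" by (rule lim_1_over_n)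
    hence "\<forall>\<^sub>F m in sequentially. 1 / real m < g e"
      using pos[OF \<open>e > 0\<close>] by (rule order_tendstoD)
    with eventually_ge_at_top[of 2]
    show "\<forall>\<^sub>F m in sequentially. dist (exp (- q m)) 0 < e"
    proof eventually_elim
      case (elim m)
      hence "g (exp (- q m)) < g e" using q[of m] by simp
      hence "\<not> e \<le> exp (- q m)"
        using mono_onD[OF mono, of e "exp (- q m)"] \<open>e > 0\<close> by auto
      thus ?case by simp
    qed
  qed
  hence "filterlim (\<lambda>m. exp (- q m)) (at_right 0) sequentially"
    by (simp add: filterlim_at)
  from filterlim_compose[OF lim this]
  have "(\<lambda>m. ln (g (exp (- q m))) / (- q m)) \<longlonglongrightarrow> \<Delta>" by simp
  moreover have "\<forall>\<^sub>F m in sequentially. ln (g (exp (- q m))) / (- q m) = ln (real m) / q m"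
    using eventually_ge_at_top[of 2]
    by eventually_elim (simp add: q ln_div)
  ultimately have "(\<lambda>m. ln (real m) / q m) \<longlonglongrightarrow> \<Delta>"
    by (rule Lim_transform_eventually)
  thus ?thesis by (simp add: q_def)
qed

text \<open>Almost every point belongs to the support: a point with a null ball around it lies in a null
  member of a countable base.\<close>

lemma AE_measure_ball_pos:
  fixes M \<Omega> :: "'a::metric_space set"
  assumes sc: "second_countable (top_of_set M)" and sub: "\<Omega> \<subseteq> M"
    and sets: "sets \<nu> = sets (restrict_space borel \<Omega>)" and "finite_measure \<nu>"
  shows "AE \<zeta> in \<nu>. \<forall>r>0. measure \<nu> (ball \<zeta> r \<inter> \<Omega>) > 0"
proof -
  interpret finite_measure \<nu> by fact
  have space: "space \<nu> = \<Omega>"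
    using sets_eq_imp_space_eq[OF sets] by (simp add: space_restrict_space)
  have open_sets: "T \<inter> \<Omega> \<in> sets \<nu>" if "open T" for T
    unfolding sets sets_restrict_space Int_commute[of T] using that by (intro imageI borel_open)
  obtain B where "countable B" and B: "\<forall>V\<in>B. openin (top_of_set M) V"
    and base: "\<forall>U x. openin (top_of_set M) U \<and> x \<in> U \<longrightarrow> (\<exists>V\<in>B. x \<in> V \<and> V \<subseteq> U)"
    using sc[unfolded second_countable_def] by (elim exE conjE) (rule that)
  have B_sets: "V \<inter> \<Omega> \<in> sets \<nu>" if V: "V \<in> B" for V
  proof -
    obtain T where "open T" "V = M \<inter> T" using bspec[OF B V] by (auto simp: openin_open)
    hence "V \<inter> \<Omega> = T \<inter> \<Omega>" using sub by blast
    thus ?thesis using open_sets[OF \<open>open T\<close>] by simp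
  qed
  define B0 where "B0 = {V \<in> B. measure \<nu> (V \<inter> \<Omega>) = 0}"
  have "(\<Union>V\<in>B0. V \<inter> \<Omega>) \<in> null_sets \<nu>"
  proof (rule null_sets_UN')
    show "countable B0"
      unfolding B0_def using \<open>countable B\<close> by (rule countable_subset[rotated]) auto
    show "V \<inter> \<Omega> \<in> null_sets \<nu>" if "V \<in> B0" for V
      using that B_sets[of V] by (auto simp: B0_def emeasure_eq_measure null_sets_def)
  qed
  hence "AE \<zeta> in \<nu>. \<zeta> \<notin> (\<Union>V\<in>B0. V \<inter> \<Omega>)" by (rule AE_not_in)
  with AE_space show ?thesis
  proof eventually_elim
    case (elim \<zeta>)
    hence \<zeta>: "\<zeta> \<in> \<Omega>" by (simp add: space)
    show ?case
    proof (intro allI impI)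
      fix r :: real assume "r > 0"
      have "openin (top_of_set M) (M \<inter> ball \<zeta> r)" by (auto simp: openin_open)
      moreover have "\<zeta> \<in> M \<inter> ball \<zeta> r" using \<zeta> sub \<open>r > 0\<close> by auto
      ultimately obtain V where V: "V \<in> B" "\<zeta> \<in> V" "V \<subseteq> M \<inter> ball \<zeta> r" using base by blast
      have "V \<notin> B0" using elim(2) V(2) \<zeta> by blast
      hence "0 < measure \<nu> (V \<inter> \<Omega>)"
        using V(1) by (simp add: B0_def zero_less_measure_iff)
      also have "\<dots> \<le> measure \<nu> (ball \<zeta> r \<inter> \<Omega>)"
        using V(3) by (intro finite_measure_mono open_sets) auto
      finally show "measure \<nu> (ball \<zeta> r \<inter> \<Omega>) > 0" .
    qed
  qed
qed

lemma measure_ball_tendsto_singleton: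
  fixes \<zeta> :: "'a::metric_space"
  assumes "finite_measure \<nu>" and "\<zeta> \<in> \<Omega>" and "\<And>r. ball \<zeta> r \<inter> \<Omega> \<in> sets \<nu>"
  shows "(\<lambda>n. measure \<nu> (ball \<zeta> (1 / real (Suc n)) \<inter> \<Omega>)) \<longlonglongrightarrow> measure \<nu> {\<zeta>}"
proof -
  interpret finite_measure \<nu> by fact
  have "(\<Inter>n. ball \<zeta> (1 / real (Suc n)) \<inter> \<Omega>) = {\<zeta>}"
  proof (intro set_eqI iffI)
    fix x assume x: "x \<in> (\<Inter>n. ball \<zeta> (1 / real (Suc n)) \<inter> \<Omega>)"
    show "x \<in> {\<zeta>}"
    proof (rule ccontr)
      assume "x \<notin> {\<zeta>}"
      then obtain n where "inverse (real (Suc n)) < dist \<zeta> x"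
        using reals_Archimedean[of "dist \<zeta> x"] by auto
      moreover have "dist \<zeta> x < 1 / real (Suc n)" using x by auto
      ultimately show False by (simp add: field_simps)
    qed
  qed (use \<open>\<zeta> \<in> \<Omega>\<close> in auto)
  moreover have "decseq (\<lambda>n. ball \<zeta> (1 / real (Suc n)) \<inter> \<Omega>)"
    unfolding decseq_def by (intro allI impI Int_mono subset_ball) (auto simp: field_simps)
  ultimately show ?thesis
    using finite_Lim_measure_decseq[of "\<lambda>n. ball \<zeta> (1 / real (Suc n)) \<inter> \<Omega>"] assms(3) by auto
qed

lemma measure_ball_tendsto_space:
  fixes \<zeta> :: "'a::metric_space"
  assumes "finite_measure \<nu>" and "\<And>r. ball \<zeta> r \<inter> \<Omega> \<in> sets \<nu>"
  shows "(\<lambda>n. measure \<nu> (ball \<zeta> (real n) \<inter> \<Omega>)) \<longlonglongrightarrow> measure \<nu> \<Omega>"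
proof -
  interpret finite_measure \<nu> by fact
  have "(\<Union>n. ball \<zeta> (real n) \<inter> \<Omega>) = \<Omega>"
    using reals_Archimedean2[of "dist \<zeta> _"] by (auto simp: set_eq_iff)
  moreover have "incseq (\<lambda>n. ball \<zeta> (real n) \<inter> \<Omega>)"
    unfolding incseq_def by (intro allI impI Int_mono subset_ball) auto
  ultimately show ?thesis
    using finite_Lim_measure_incseq[of "\<lambda>n. ball \<zeta> (real n) \<inter> \<Omega>"] assms(2) by auto
qed

text \<open>The value \<open>\<infinity>\<close> at \<open>x = \<zeta>\<close> is the one that matches the centre of the ball.\<close>

lemma distr_fun_log_dist:
  assumes "prob_space \<nu>" and "ball \<zeta> (exp (- u)) \<inter> space \<nu> \<in> sets \<nu>"
  shows "distr_fun \<nu> (log_dist_process f \<zeta> 0) u = 1 - measure \<nu> (ball \<zeta> (exp (- u)) \<inter> space \<nu>)"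
proof -
  interpret prob_space \<nu> by fact
  have "log_dist_process f \<zeta> 0 x \<le> ereal u \<longleftrightarrow> x \<notin> ball \<zeta> (exp (- u))" for x
  proof (cases "x = \<zeta>")
    case False
    hence "- ln (dist x \<zeta>) \<le> u \<longleftrightarrow> exp (- u) \<le> dist x \<zeta>"
      using ln_ge_iff[of "dist x \<zeta>" "- u"] by auto
    thus ?thesis using False by (simp add: log_dist_process_def dist_commute not_less)
  qed (simp add: log_dist_process_def)
  hence "{x \<in> space \<nu>. log_dist_process f \<zeta> 0 x \<le> ereal u}
    = space \<nu> - ball \<zeta> (exp (- u)) \<inter> space \<nu>" by blast
  thus ?thesis
    unfolding distr_fun_def using prob_compl[OF assms(2)] by simp
qed

theorem proposition1:
  fixes M \<Omega> :: "'a::metric_space set"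
    and d :: nat
    and \<nu> :: "'a measure"
    and f :: "'a \<Rightarrow> 'a"
    and \<Delta> :: real
  assumes "topological_manifold d M" and "\<Omega> \<subseteq> M"
    and "sets \<nu> = sets (restrict_space borel \<Omega>)" and "prob_space \<nu>"
    and "f \<in> measurable \<nu> \<nu>" and "distr \<nu> \<nu> f = \<nu>"
    and "AE \<zeta> in \<nu>. \<exists>a b. normalising_seqs \<nu> (log_dist_process f \<zeta>) a b \<and>
           (\<forall>y. condition_D2 \<nu> (log_dist_process f \<zeta>) (\<lambda>m. y / a m + b m) \<and>
                condition_D' \<nu> (log_dist_process f \<zeta>) (\<lambda>m. y / a m + b m))"
    and "AE \<zeta> in \<nu>. continuous_on {0<..} (\<lambda>r. measure \<nu> (ball \<zeta> r \<inter> \<Omega>))"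
    and "\<forall>x\<in>\<Omega>. measure \<nu> {x} = 0"
    and "AE \<zeta> in \<nu>. ((\<lambda>r. ln (measure \<nu> (ball \<zeta> r \<inter> \<Omega>)) / ln r) \<longlongrightarrow> \<Delta>) (at_right 0)"
  shows "AE \<zeta> in \<nu>.
           (\<lambda>m. ln (real m) / quantile_seq \<nu> (log_dist_process f \<zeta> 0) m) \<longlonglongrightarrow> \<Delta>"
proof -
  interpret prob_space \<nu> by fact
  have space: "space \<nu> = \<Omega>"
    using sets_eq_imp_space_eq[OF assms(3)] by (simp add: space_restrict_space)
  have ball_sets: "ball \<zeta> r \<inter> \<Omega> \<in> sets \<nu>" for \<zeta> r
    unfolding assms(3) sets_restrict_space Int_commute[of "ball \<zeta> r"]
    by (intro imageI borel_open open_ball)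
  have sc: "second_countable (top_of_set M)"
    using assms(1) by (simp add: topological_manifold_def)
  from AE_measure_ball_pos[OF sc assms(2,3) finite_measure_axioms] AE_space assms(8,10)
  show ?thesis
  proof eventually_elim
    case (elim \<zeta>)
    hence \<zeta>: "\<zeta> \<in> \<Omega>" by (simp add: space)
    define g where "g r = measure \<nu> (ball \<zeta> r \<inter> \<Omega>)" for r
    have "(\<lambda>m. ln (real m) / Inf {u. g (exp (- u)) \<le> 1 / real m}) \<longlonglongrightarrow> \<Delta>"
    proof (rule ln_over_quantile_tendsto)
      show "continuous_on {0<..} g" using elim(3) by (simp add: g_def)
      show "mono_on {0<..} g"
        unfolding g_def by (intro mono_onI finite_measure_mono ball_sets Int_mono subset_ball) auto
      show "g r > 0" if "r > 0" for r using elim(1) that by (simp add: g_def)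
      show "((\<lambda>r. ln (g r) / ln r) \<longlongrightarrow> \<Delta>) (at_right 0)" using elim(4) by (simp add: g_def)
      show "\<exists>r>0. g r < e" if "e > 0" for e
      proof -
        have "(\<lambda>n. g (1 / real (Suc n))) \<longlonglongrightarrow> 0"
          using measure_ball_tendsto_singleton[OF finite_measure_axioms \<zeta> ball_sets] assms(9) \<zeta>
          by (simp add: g_def)
        from order_tendstoD(2)[OF this that] obtain n where "g (1 / real (Suc n)) < e"
          by (auto simp: eventually_sequentially)
        thus ?thesis by (intro exI[of _ "1 / real (Suc n)"]) simp
      qed
      show "\<exists>r>0. e < g r" if "e < 1" for e
      proof -
        have "(\<lambda>n. g (real n)) \<longlonglongrightarrow> 1"
          using measure_ball_tendsto_space[OF finite_measure_axioms ball_sets] prob_space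
          by (simp add: g_def space)
        from eventually_conj[OF order_tendstoD(1)[OF this that] eventually_gt_at_top[of 0]]
        obtain n where "e < g (real n)" "n > 0"
          by (auto simp: eventually_sequentially)
        thus ?thesis by (intro exI[of _ "real n"]) simp
      qed
    qed
    moreover have "quantile_seq \<nu> (log_dist_process f \<zeta> 0) m
      = Inf {u. g (exp (- u)) \<le> 1 / real m}" for m
      unfolding quantile_seq_def
      using ball_sets by (simp add: distr_fun_log_dist[OF prob_space_axioms] space g_def)
    ultimately show ?case by simp
  qed
qed

end
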